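(* Consider the minimum weight bipartite matching problem for two multisets $R,B$ of $n$ points each in the $d$-dimensional Boolean hypercube $Q_d$ with the $\ell_1$ metric. Let $\xi>1$ and suppose the instance is $(\eta,\zeta)$-bounded with $\eta=O(d^{\frac{1}{\xi\log_2 3/2}})$. Then the greedy algorithm achieves an approximation factor of $$\max\left\{2\zeta,\ O\!\left(d^{\frac{1+\xi\log_2(3/2)}{\xi(1+\log_2(3/2))}}\right)\right\},$$ i.e., the weight of the greedy matching is at most this factor times the weight of a minimum weight perfect matching.
   Context: An instance is $(\eta,\zeta)$-bounded if all points of $R\cup B$ can be covered by $\eta$ $\ell_1$-balls of radius $\zeta$ lying within $Q_d$. The greedy algorithm repeatedly matches a pair of currently unmatched points $r\in R$, $b\in B$ at minimum $\ell_1$ distance among all unmatched pairs (ties broken arbitrarily). The weight of a matching is the sum of the $\ell_1$ lengths of its edges. Asymptotics are as $d\to\infty$. *)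

theory Defs
  imports Complex_Main
begin

definition hypercube :: "nat \<Rightarrow> bool list set" where
  "hypercube d = {x. length x = d}"

definition l1dist :: "bool list \<Rightarrow> bool list \<Rightarrow> nat" where
  "l1dist x y = card {i. i < length x \<and> i < length y \<and> x ! i \<noteq> y ! i}"

text \<open>A multiset of n points is given as an indexed family r 0, ..., r (n-1).
  A perfect matching between R and B is a bijection sigma of {..<n}: r i is
  matched with b (sigma i).\<close>
definition perfect_matching :: "nat \<Rightarrow> (nat \<Rightarrow> nat) \<Rightarrow> bool" where
  "perfect_matching n \<sigma> \<longleftrightarrow> bij_betw \<sigma> {..<n} {..<n}"

definition matching_weight ::
  "nat \<Rightarrow> (nat \<Rightarrow> bool list) \<Rightarrow> (nat \<Rightarrow> bool list) \<Rightarrow> (nat \<Rightarrow> nat) \<Rightarrow> real" where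
  "matching_weight n r b \<sigma> = (\<Sum>i<n. real (l1dist (r i) (b (\<sigma> i))))"

text \<open>sigma is a possible output of the greedy algorithm (arbitrary tie breaking):
  there is an order pi in which the R-points get matched, and at step k the pair
  (r (pi k), b (sigma (pi k))) has minimum distance among all currently unmatched pairs.\<close>
definition greedy_matching ::
  "nat \<Rightarrow> (nat \<Rightarrow> bool list) \<Rightarrow> (nat \<Rightarrow> bool list) \<Rightarrow> (nat \<Rightarrow> nat) \<Rightarrow> bool" where
  "greedy_matching n r b \<sigma> \<longleftrightarrow> perfect_matching n \<sigma> \<and>
     (\<exists>\<pi>. bij_betw \<pi> {..<n} {..<n} \<and>
        (\<forall>k<n. \<forall>i<n. \<forall>j<n. i \<notin> \<pi> ` {..<k} \<longrightarrow> j \<notin> \<sigma> ` \<pi> ` {..<k} \<longrightarrow>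
            l1dist (r (\<pi> k)) (b (\<sigma> (\<pi> k))) \<le> l1dist (r i) (b j)))"

definition bounded_instance ::
  "nat \<Rightarrow> nat \<Rightarrow> (nat \<Rightarrow> bool list) \<Rightarrow> (nat \<Rightarrow> bool list) \<Rightarrow> nat \<Rightarrow> real \<Rightarrow> bool" where
  "bounded_instance d n r b \<eta> \<zeta> \<longleftrightarrow>
     (\<exists>c. (\<forall>k<\<eta>. c k \<in> hypercube d) \<and>
          (\<forall>i<n. (\<exists>k<\<eta>. real (l1dist (c k) (r i)) \<le> \<zeta>) \<and>
                 (\<exists>k<\<eta>. real (l1dist (c k) (b i)) \<le> \<zeta>)))"

end

theory Submission
  imports Defs
begin

text \<open>
  Write \<open>p = log 2 3\<close>. While greedy runs, the still unmatched points keep a perfect matching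
  \<open>\<rho>\<close> whose edges carry weights \<open>w\<close> of total at most the weight of \<open>\<tau>\<close>, such that every edge has
  length at most \<open>w powr p\<close>. When greedy removes a pair, the two \<open>\<rho>\<close>-edges at its ends are merged
  through the greedy edge, which is no longer than either of them; their weights add up, and
  \<open>x powr p + y powr p + min x y powr p \<le> (x + y) powr p\<close> preserves the bound. If greedy is about
  to use an edge of length at least \<open>l\<close>, all remaining \<open>\<rho>\<close>-edges are that long, so at most
  \<open>l powr (- 1 / p)\<close> times the weight of \<open>\<tau>\<close> many points remain. Summing over \<open>l = 1, \<dots>, d\<close>
  gives the factor \<open>O(d powr (1 - 1 / p))\<close>, whose exponent is at most the claimed one.
\<close>

section \<open>Power inequalities\<close>

lemma powr_increment_mono:
  fixes p x y :: real
  assumes "1 \<le> p" "0 < y" "y \<le> x"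
  shows "(y + y) powr p - y powr p \<le> (x + y) powr p - x powr p"
proof (rule DERIV_nonneg_imp_nondecreasing[OF assms(3)])
  fix s assume s: "y \<le> s" "s \<le> x"
  have "((\<lambda>s. (s + y) powr p - s powr p) has_real_derivative
      p * (s + y) powr (p - 1) - p * s powr (p - 1)) (at s)"
    using s assms by (auto intro!: derivative_eq_intros)
  moreover have "s powr (p - 1) \<le> (s + y) powr (p - 1)"
    using s assms by (intro powr_mono2) auto
  then have "0 \<le> p * (s + y) powr (p - 1) - p * s powr (p - 1)"
    using assms by (simp add: mult_left_mono)
  ultimately show "\<exists>D. ((\<lambda>s. (s + y) powr p - s powr p) has_real_derivative D) (at s) \<and> 0 \<le> D"
    by blast
qed

lemma powr_log2_3_merge:
  fixes x y :: real
  assumes "0 \<le> x" "0 \<le> y"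
  shows "x powr log 2 3 + y powr log 2 3 + min (x powr log 2 3) (y powr log 2 3)
    \<le> (x + y) powr log 2 3"
proof -
  have *: "x powr log 2 3 + y powr log 2 3 + y powr log 2 3 \<le> (x + y) powr log 2 3"
    if "0 \<le> y" "y \<le> x" for x y :: real
  proof (cases "y = 0")
    case False
    then have y: "0 < y" using that by simp
    have "(y + y) powr log 2 3 = (2 * y) powr log 2 3" by simp
    also have "\<dots> = 3 * y powr log 2 3" using y by (subst powr_mult) simp_all
    finally have "(y + y) powr log 2 3 = 3 * y powr log 2 3" .
    with powr_increment_mono[of "log 2 3" y x] y that show ?thesis by simp
  qed simp
  show ?thesis
  proof (cases "y \<le> x")
    case True
    then show ?thesis using *[of y x] assms by (simp add: min_def)
  next
    case False
    then show ?thesis using *[of x y] assms by (simp add: min_def add.commute)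
  qed
qed

lemma sum_powr_le:
  fixes q :: real
  assumes "0 < q" "q \<le> 1"
  shows "(\<Sum>l=1..d. real l powr (q - 1)) \<le> real d powr q / q"
proof (induction d)
  case (Suc d)
  have "q * real (Suc d) powr (q - 1) \<le> real (Suc d) powr q - real d powr q"
  proof (cases "d = 0")
    case False
    have "\<exists>z. real d < z \<and> z < real (Suc d) \<and>
        real (Suc d) powr q - real d powr q = (real (Suc d) - real d) * (q * z powr (q - 1))"
      using False by (intro MVT2) (auto intro!: derivative_eq_intros)
    then obtain z where z: "real d < z" "z < real (Suc d)"
        "real (Suc d) powr q - real d powr q = q * z powr (q - 1)"
      by auto
    have "real (Suc d) powr (q - 1) \<le> z powr (q - 1)"
      using z assms by (intro powr_mono2') auto
    then show ?thesis using z(3) assms by simp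
  qed (use assms in simp)
  then have "real (Suc d) powr (q - 1) \<le> real (Suc d) powr q / q - real d powr q / q"
    using assms by (simp add: field_simps)
  with Suc show ?case by simp
qed simp

section \<open>Distances in the hypercube\<close>

lemma l1dist_commute: "l1dist x y = l1dist y x"
  unfolding l1dist_def by (rule arg_cong[where f = card]) auto

lemma l1dist_triangle:
  assumes "x \<in> hypercube d" "y \<in> hypercube d" "z \<in> hypercube d"
  shows "l1dist x z \<le> l1dist x y + l1dist y z"
proof -
  have "l1dist x z \<le> card ({i. i < length x \<and> i < length y \<and> x ! i \<noteq> y ! i}
      \<union> {i. i < length y \<and> i < length z \<and> y ! i \<noteq> z ! i})"
    unfolding l1dist_def using assms by (intro card_mono) (auto simp: hypercube_def)
  also have "\<dots> \<le> l1dist x y + l1dist y z"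
    unfolding l1dist_def by (rule card_Un_le)
  finally show ?thesis .
qed

lemma l1dist_le:
  assumes "x \<in> hypercube d"
  shows "l1dist x y \<le> d"
proof -
  have "l1dist x y \<le> card {..<d}"
    unfolding l1dist_def using assms by (intro card_mono) (auto simp: hypercube_def)
  then show ?thesis by simp
qed

section \<open>The residual matching\<close>

definition residual_matching ::
  "('a \<Rightarrow> 'b \<Rightarrow> nat) \<Rightarrow> 'a set \<Rightarrow> 'b set \<Rightarrow> real \<Rightarrow> bool" where
  "residual_matching \<delta> A B W \<longleftrightarrow> (\<exists>\<rho> w. bij_betw \<rho> A B \<and>
     (\<forall>i\<in>A. 0 \<le> w i \<and> real (\<delta> i (\<rho> i)) \<le> w i powr log 2 3) \<and> sum w A \<le> W)"

lemma residual_matching_remove: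
  fixes \<delta> :: "'a \<Rightarrow> 'b \<Rightarrow> nat"
  assumes "residual_matching \<delta> A B W" and fin: "finite A" and a: "a \<in> A" and y: "y \<in> B"
    and least: "\<And>i j. i \<in> A \<Longrightarrow> j \<in> B \<Longrightarrow> \<delta> a y \<le> \<delta> i j"
    and detour: "\<And>i j. i \<in> A \<Longrightarrow> j \<in> B \<Longrightarrow> \<delta> i j \<le> \<delta> i y + \<delta> a y + \<delta> a j"
  shows "residual_matching \<delta> (A - {a}) (B - {y}) W"
proof -
  obtain \<rho> w where bij: "bij_betw \<rho> A B"
    and w: "\<And>i. i \<in> A \<Longrightarrow> 0 \<le> w i" "\<And>i. i \<in> A \<Longrightarrow> real (\<delta> i (\<rho> i)) \<le> w i powr log 2 3"
    and W: "sum w A \<le> W"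
    using assms(1) unfolding residual_matching_def by blast
  from bij have inj: "inj_on \<rho> A" and img: "\<rho> ` A = B" by (auto simp: bij_betw_def)
  then obtain a' where a': "a' \<in> A" "\<rho> a' = y" using y by blast
  have eq: "\<rho> i = y \<longleftrightarrow> i = a'" if "i \<in> A" for i
    using that a' inj by (auto dest: inj_onD)
  define \<rho>' where "\<rho>' i = (if i = a' then \<rho> a else \<rho> i)" for i
  define w' where "w' i = (if i = a' then w i + w a else w i)" for i
  have "inj_on \<rho>' (A - {a})"
    using inj a a' by (auto simp: inj_on_def \<rho>'_def)
  moreover have "\<rho>' ` (A - {a}) = B - {y}"
  proof
    show "\<rho>' ` (A - {a}) \<subseteq> B - {y}"
      using a a' img eq by (auto simp: \<rho>'_def)
    show "B - {y} \<subseteq> \<rho>' ` (A - {a})"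
    proof
      fix j assume j: "j \<in> B - {y}"
      then obtain i where i: "i \<in> A" "\<rho> i = j" using img by blast
      then have "i \<noteq> a'" using a' j by auto
      show "j \<in> \<rho>' ` (A - {a})"
      proof (cases "i = a")
        case True
        then have "j = \<rho>' a'" "a' \<in> A - {a}" using i a' \<open>i \<noteq> a'\<close> by (auto simp: \<rho>'_def)
        then show ?thesis by blast
      next
        case False
        then have "j = \<rho>' i" "i \<in> A - {a}" using i \<open>i \<noteq> a'\<close> by (auto simp: \<rho>'_def)
        then show ?thesis by blast
      qed
    qed
  qed
  moreover have "0 \<le> w' i \<and> real (\<delta> i (\<rho>' i)) \<le> w' i powr log 2 3" if "i \<in> A - {a}" for i
  proof (cases "i = a'")
    case True
    have "\<rho> a \<in> B" using a img by blast
    then have "\<delta> a' (\<rho> a) \<le> \<delta> a' y + \<delta> a y + \<delta> a (\<rho> a)"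
      "\<delta> a y \<le> \<delta> a' y" "\<delta> a y \<le> \<delta> a (\<rho> a)"
      using a a'(1) y by (blast intro: detour least)+
    moreover have "real (\<delta> a' y) \<le> w a' powr log 2 3" using w(2)[of a'] a' by simp
    moreover note w(2)[OF a]
    ultimately have "real (\<delta> a' (\<rho> a)) \<le> w a' powr log 2 3 + w a powr log 2 3
        + min (w a' powr log 2 3) (w a powr log 2 3)"
      by linarith
    also have "\<dots> \<le> (w a' + w a) powr log 2 3"
      using w a a' by (intro powr_log2_3_merge) auto
    finally show ?thesis using True w(1) a a' by (simp add: \<rho>'_def w'_def)
  next
    case False
    then show ?thesis using w that by (simp add: \<rho>'_def w'_def)
  qed
  moreover have "sum w' (A - {a}) \<le> W"
  proof -
    have "sum w' (A - {a}) = sum w (A - {a}) + (\<Sum>i\<in>A - {a}. if i = a' then w a else 0)"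
      unfolding sum.distrib[symmetric] by (rule sum.cong) (auto simp: w'_def)
    also have "\<dots> \<le> sum w (A - {a}) + w a"
      using fin w(1)[OF a] by simp
    also have "\<dots> = sum w A" using fin a by (simp add: sum.remove)
    finally show ?thesis using W by simp
  qed
  ultimately show ?thesis
    unfolding residual_matching_def bij_betw_def by blast
qed

lemma residual_matching_card:
  fixes \<delta> :: "'a \<Rightarrow> 'b \<Rightarrow> nat"
  assumes "residual_matching \<delta> A B W" and long: "\<And>i j. i \<in> A \<Longrightarrow> j \<in> B \<Longrightarrow> l \<le> \<delta> i j"
  shows "real (card A) * real l powr (1 / log 2 3) \<le> W"
proof -
  obtain \<rho> w where bij: "bij_betw \<rho> A B"
    and w: "\<And>i. i \<in> A \<Longrightarrow> 0 \<le> w i" "\<And>i. i \<in> A \<Longrightarrow> real (\<delta> i (\<rho> i)) \<le> w i powr log 2 3"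
    and W: "sum w A \<le> W"
    using assms(1) unfolding residual_matching_def by blast
  have "real l powr (1 / log 2 3) \<le> w i" if "i \<in> A" for i
  proof -
    have "\<rho> i \<in> B" using that bij by (auto simp: bij_betw_def)
    then have "real l \<le> w i powr log 2 3" using long[OF that] w(2)[OF that] by force
    then have "real l powr (1 / log 2 3) \<le> (w i powr log 2 3) powr (1 / log 2 3)"
      by (intro powr_mono2) auto
    also have "\<dots> = w i"
    proof -
      have "log 2 3 \<noteq> (0::real)" using zero_less_log_cancel_iff[of 2 "3::real"] by linarith
      then show ?thesis using w(1)[OF that] by (simp add: powr_powr)
    qed
    finally show ?thesis .
  qed
  then have "(\<Sum>i\<in>A. real l powr (1 / log 2 3)) \<le> sum w A" by (rule sum_mono)
  with W show ?thesis by simp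
qed

section \<open>The greedy matching\<close>

lemma greedy_residual_matching:
  assumes cube: "\<forall>i<n. r i \<in> hypercube d \<and> b i \<in> hypercube d"
    and \<sigma>: "bij_betw \<sigma> {..<n} {..<n}" and \<pi>: "bij_betw \<pi> {..<n} {..<n}"
    and greedy: "\<forall>k<n. \<forall>i<n. \<forall>j<n. i \<notin> \<pi> ` {..<k} \<longrightarrow> j \<notin> \<sigma> ` \<pi> ` {..<k} \<longrightarrow>
      l1dist (r (\<pi> k)) (b (\<sigma> (\<pi> k))) \<le> l1dist (r i) (b j)"
    and \<tau>: "perfect_matching n \<tau>" and "k \<le> n"
  shows "residual_matching (\<lambda>i j. l1dist (r i) (b j))
    ({..<n} - \<pi> ` {..<k}) ({..<n} - \<sigma> ` \<pi> ` {..<k}) (matching_weight n r b \<tau>)"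
  using \<open>k \<le> n\<close>
proof (induction k)
  case 0
  have "real m \<le> real m powr log 2 3" for m :: nat
  proof (cases "m = 0")
    case False
    then have "real m powr 1 \<le> real m powr log 2 3" by (intro powr_mono) auto
    then show ?thesis by simp
  qed simp
  then show ?case
    using \<tau> unfolding residual_matching_def perfect_matching_def matching_weight_def
    by (intro exI[of _ \<tau>] exI[of _ "\<lambda>i. real (l1dist (r i) (b (\<tau> i)))"]) auto
next
  case (Suc k)
  let ?A = "{..<n} - \<pi> ` {..<k}" and ?B = "{..<n} - \<sigma> ` \<pi> ` {..<k}"
  have k: "k < n" using Suc by simp
  have \<pi>k: "\<pi> k < n" "\<pi> k \<notin> \<pi> ` {..<k}"
    using \<pi> k inj_on_image_mem_iff[of \<pi> "{..<n}" k "{..<k}"] by (auto simp: bij_betw_def)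
  have \<pi>sub: "\<pi> ` {..<k} \<subseteq> {..<n}"
    using \<pi> k by (auto simp: bij_betw_def)
  have \<sigma>k: "\<sigma> (\<pi> k) < n" "\<sigma> (\<pi> k) \<notin> \<sigma> ` \<pi> ` {..<k}"
    using \<sigma> \<pi>k \<pi>sub inj_on_image_mem_iff[of \<sigma> "{..<n}" "\<pi> k" "\<pi> ` {..<k}"]
    by (auto simp: bij_betw_def)
  have "residual_matching (\<lambda>i j. l1dist (r i) (b j)) (?A - {\<pi> k}) (?B - {\<sigma> (\<pi> k)})
      (matching_weight n r b \<tau>)"
  proof (rule residual_matching_remove)
    show "l1dist (r (\<pi> k)) (b (\<sigma> (\<pi> k))) \<le> l1dist (r i) (b j)" if "i \<in> ?A" "j \<in> ?B" for i j
      using greedy k that by blast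
    show "l1dist (r i) (b j) \<le> l1dist (r i) (b (\<sigma> (\<pi> k)))
        + l1dist (r (\<pi> k)) (b (\<sigma> (\<pi> k))) + l1dist (r (\<pi> k)) (b j)"
      if "i \<in> ?A" "j \<in> ?B" for i j
      using l1dist_triangle[of "r i" d "b (\<sigma> (\<pi> k))" "b j"]
        l1dist_triangle[of "b (\<sigma> (\<pi> k))" d "r (\<pi> k)" "b j"]
        l1dist_commute[of "b (\<sigma> (\<pi> k))" "r (\<pi> k)"] cube that \<pi>k(1) \<sigma>k(1)
      by simp
  qed (use Suc \<pi>k \<sigma>k in auto)
  moreover have "?A - {\<pi> k} = {..<n} - \<pi> ` {..<Suc k}"
    "?B - {\<sigma> (\<pi> k)} = {..<n} - \<sigma> ` \<pi> ` {..<Suc k}"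
    by (auto simp: lessThan_Suc)
  ultimately show ?case by simp
qed

lemma greedy_long_edges:
  assumes cube: "\<forall>i<n. r i \<in> hypercube d \<and> b i \<in> hypercube d"
    and greedy: "greedy_matching n r b \<sigma>" and \<tau>: "perfect_matching n \<tau>" and "0 < l"
  shows "real (card {i\<in>{..<n}. l \<le> l1dist (r i) (b (\<sigma> i))})
    \<le> real l powr (- 1 / log 2 3) * matching_weight n r b \<tau>"
proof -
  let ?L = "{i\<in>{..<n}. l \<le> l1dist (r i) (b (\<sigma> i))}"
  obtain \<pi> where \<sigma>: "bij_betw \<sigma> {..<n} {..<n}" and \<pi>: "bij_betw \<pi> {..<n} {..<n}"
    and least: "\<forall>k<n. \<forall>i<n. \<forall>j<n. i \<notin> \<pi> ` {..<k} \<longrightarrow> j \<notin> \<sigma> ` \<pi> ` {..<k} \<longrightarrow>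
      l1dist (r (\<pi> k)) (b (\<sigma> (\<pi> k))) \<le> l1dist (r i) (b j)"
    using greedy unfolding greedy_matching_def perfect_matching_def by blast
  have W: "0 \<le> matching_weight n r b \<tau>"
    unfolding matching_weight_def by (simp add: sum_nonneg)
  show ?thesis
  proof (cases "?L = {}")
    case True
    show ?thesis unfolding True using W by simp
  next
    case False
    then obtain i where i: "i \<in> ?L" by blast
    moreover have "i \<in> \<pi> ` {..<n}" using i \<pi> by (auto simp: bij_betw_def)
    ultimately have ex: "\<exists>k. k < n \<and> \<pi> k \<in> ?L" by blast
    define k where "k = (LEAST k. k < n \<and> \<pi> k \<in> ?L)"
    have k: "k < n" "\<pi> k \<in> ?L" using LeastI_ex[OF ex] by (auto simp: k_def)
    have first: "\<pi> m \<notin> ?L" if "m < k" for m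
      using not_less_Least[of m "\<lambda>k. k < n \<and> \<pi> k \<in> ?L"] that k(1) by (auto simp: k_def)
    let ?A = "{..<n} - \<pi> ` {..<k}" and ?B = "{..<n} - \<sigma> ` \<pi> ` {..<k}"
    have "real (card ?A) * real l powr (1 / log 2 3) \<le> matching_weight n r b \<tau>"
    proof (rule residual_matching_card)
      show "residual_matching (\<lambda>i j. l1dist (r i) (b j)) ?A ?B (matching_weight n r b \<tau>)"
        using k(1) by (intro greedy_residual_matching[OF cube \<sigma> \<pi> least \<tau>]) simp
      show "l \<le> l1dist (r i) (b j)" if "i \<in> ?A" "j \<in> ?B" for i j
      proof -
        have "l1dist (r (\<pi> k)) (b (\<sigma> (\<pi> k))) \<le> l1dist (r i) (b j)"
          using least k(1) that by blast
        then show ?thesis using k(2) by simp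
      qed
    qed
    moreover have "card ?L \<le> card ?A"
      using first by (intro card_mono) auto
    then have "real (card ?L) * real l powr (1 / log 2 3) \<le> real (card ?A) * real l powr (1 / log 2 3)"
      by (intro mult_right_mono) auto
    ultimately have "real (card ?L) * real l powr (1 / log 2 3) \<le> matching_weight n r b \<tau>"
      by linarith
    then show ?thesis
      using \<open>0 < l\<close> by (simp add: powr_minus field_simps)
  qed
qed

lemma greedy_approximation:
  assumes cube: "\<forall>i<n. r i \<in> hypercube d \<and> b i \<in> hypercube d"
    and greedy: "greedy_matching n r b \<sigma>" and \<tau>: "perfect_matching n \<tau>"
  shows "matching_weight n r b \<sigma>
    \<le> real d powr (1 - 1 / log 2 3) / (1 - 1 / log 2 3) * matching_weight n r b \<tau>"
proof -
  let ?g = "\<lambda>i. l1dist (r i) (b (\<sigma> i))"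
  have W: "0 \<le> matching_weight n r b \<tau>"
    unfolding matching_weight_def by (simp add: sum_nonneg)
  have "1 < log 2 (3::real)" by simp
  then have q: "0 < 1 - 1 / log 2 (3::real)" by (simp add: field_simps)
  have g: "?g i = (\<Sum>l=1..d. if l \<le> ?g i then 1 else 0)" if "i < n" for i
  proof -
    have "?g i \<le> d" using cube that l1dist_le by blast
    then have "{l\<in>{1..d}. l \<le> ?g i} = {1..?g i}" by auto
    then show ?thesis by (simp add: sum.inter_filter[symmetric])
  qed
  have "(\<Sum>i<n. ?g i) = (\<Sum>i<n. \<Sum>l=1..d. if l \<le> ?g i then 1 else 0)"
    by (intro sum.cong refl g) simp
  also have "\<dots> = (\<Sum>l=1..d. \<Sum>i<n. if l \<le> ?g i then 1 else 0)"
    by (rule sum.swap)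
  also have "\<dots> = (\<Sum>l=1..d. card {i\<in>{..<n}. l \<le> ?g i})"
    by (intro sum.cong refl) (simp add: sum.inter_filter[symmetric])
  finally have "matching_weight n r b \<sigma> = (\<Sum>l=1..d. real (card {i\<in>{..<n}. l \<le> ?g i}))"
    unfolding matching_weight_def of_nat_sum[symmetric] by (rule arg_cong[where f = real])
  also have "\<dots> \<le> (\<Sum>l=1..d. real l powr (- 1 / log 2 3) * matching_weight n r b \<tau>)"
    using greedy_long_edges[OF cube greedy \<tau>] by (intro sum_mono) auto
  also have "\<dots> = (\<Sum>l=1..d. real l powr (1 - 1 / log 2 3 - 1)) * matching_weight n r b \<tau>"
    by (simp add: sum_distrib_right)
  also have "\<dots> \<le> real d powr (1 - 1 / log 2 3) / (1 - 1 / log 2 3) * matching_weight n r b \<tau>"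
    using q W by (intro mult_right_mono sum_powr_le) auto
  finally show ?thesis .
qed

theorem theorem8:
  fixes \<xi> :: real
  assumes "\<xi> > 1"
  shows "\<forall>c\<^sub>\<eta> > 0. \<exists>C > 0. \<exists>d\<^sub>0. \<forall>d \<ge> d\<^sub>0. \<forall>n r b \<eta> \<zeta> \<sigma>.
     (\<forall>i<n. r i \<in> hypercube d \<and> b i \<in> hypercube d) \<longrightarrow>
     real \<eta> \<le> c\<^sub>\<eta> * real d powr (1 / (\<xi> * log 2 (3/2))) \<longrightarrow>
     bounded_instance d n r b \<eta> \<zeta> \<longrightarrow>
     greedy_matching n r b \<sigma> \<longrightarrow>
     (\<forall>\<tau>. perfect_matching n \<tau> \<longrightarrow>
        matching_weight n r b \<sigma> \<le>
          max (2 * \<zeta>) (C * real d powr ((1 + \<xi> * log 2 (3/2)) / (\<xi> * (1 + log 2 (3/2)))))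
          * matching_weight n r b \<tau>)"
proof -
  let ?q = "1 - 1 / log 2 (3::real)"
  let ?e = "(1 + \<xi> * log 2 (3/2)) / (\<xi> * (1 + log 2 (3/2)))"
  have p: "1 < log 2 (3::real)" by simp
  then have q: "0 < ?q" by (simp add: field_simps)
  have \<alpha>: "log 2 (3/2) = log 2 3 - (1::real)" by (simp add: log_divide)
  have "(1 + \<xi> * (t - 1)) / (\<xi> * (1 + (t - 1))) = 1 / (\<xi> * t) + (1 - 1 / t)"
    if "1 < t" for t :: real
    using assms that by (simp add: field_simps)
  from this[OF p] have "?e = 1 / (\<xi> * log 2 3) + ?q"
    unfolding \<alpha> .
  then have qe: "?q \<le> ?e" using assms p by simp
  have "matching_weight n r b \<sigma> \<le> max (2 * \<zeta>) (1 / ?q * real d powr ?e) * matching_weight n r b \<tau>"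
    if "1 \<le> d" "\<forall>i<n. r i \<in> hypercube d \<and> b i \<in> hypercube d"
      "greedy_matching n r b \<sigma>" "perfect_matching n \<tau>" for d n r b \<zeta> \<sigma> \<tau>
  proof -
    have "real d powr ?q \<le> real d powr ?e"
      using that(1) qe by (intro powr_mono) auto
    then have "real d powr ?q / ?q \<le> 1 / ?q * real d powr ?e"
      using q by (simp add: divide_right_mono)
    then have "real d powr ?q / ?q \<le> max (2 * \<zeta>) (1 / ?q * real d powr ?e)"
      by linarith
    moreover have "0 \<le> matching_weight n r b \<tau>"
      unfolding matching_weight_def by (simp add: sum_nonneg)
    ultimately show ?thesis
      using greedy_approximation[OF that(2-4)] by (meson mult_right_mono order_trans)
  qed
  then show ?thesis
    using q by (intro allI impI exI[of _ "1 / ?q"] exI[of _ "1::nat"] conjI) auto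
qed

end
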